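(* Let $\mathbb{M}$ be $(1+3)$-dimensional Minkowski spacetime and $\overline{\mathcal{P}}_+^\uparrow=\mathbb{R}^4\rtimes SL(2,\mathbb{C})$ the double cover of the proper orthochronous Poincaré group, with elements $(a,A)$ and identity $e\in SL(2,\mathbb{C})$, and let $\Lambda:SL(2,\mathbb{C})\to SO^+(1,3)$ be the covering homomorphism. Let $\mathcal{H}$ be a Hilbert space, $\mathcal{D}\subset\mathcal{H}$ dense, and $U$ a unitary representation of $\overline{\mathcal{P}}_+^\uparrow$ on $\mathcal{H}$. Let $S:SL(2,\mathbb{C})\to GL(\mathbb{C}^n)$ be the finite-dimensional representation $S[A]=D^{(0,0)}[A]\oplus D^{(j_1,j_2)}[A]$ for all $A$, where $(j_1,j_2)\neq(0,0)$ and $D^{(j_1,j_2)}$ is irreducible, written in a basis in which index $1$ spans the trivial summand $D^{(0,0)}$ and indices $2,\dots,n$ span $D^{(j_1,j_2)}$. Let $\{\hat\psi_\alpha:\mathbb{M}\to\mathcal{L}(\mathcal{D},\mathcal{H})\}_{\alpha=1}^n$. Suppose (1) $U$ is weakly continuous; (2) $U(a,A)\mathcal{D}\subset\mathcal{D}$ and $U(a,A)^\dagger\mathcal{D}\subset\mathcal{D}$ for all $(a,A)$; (3) $\hat\psi_\alpha(x)\mathcal{D}\subset\mathcal{D}$ and $\hat\psi_\alpha(x)^\dagger\mathcal{D}\subset\mathcal{D}$ for all $x\in\mathbb{M}$ and all $\alpha$; (4) for all $(a,A)\in\overline{\mathcal{P}}_+^\uparrow$, $x\in\mathbb{M}$,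 $\alpha$, on $\mathcal{D}$: $U(a,A)\hat\psi_\alpha(x)U(a,A)^\dagger=\sum_{\beta=1}^nS[A^{-1}]_{\alpha\beta}\hat\psi_\beta(\Lambda(A)x+a)$; (5) there exists a nonzero vector $\ket\Omega\in\mathcal{D}$, unique up to scalar multiples, with $U(x,e)\ket\Omega=\ket\Omega$ for all $x\in\mathbb{M}$. Then there exists $c\in\mathbb{C}$ such that for all $x\in\mathbb{M}$: $\hat\psi_1(x)\ket\Omega=c\ket\Omega$, $\hat\psi_1(x)^\dagger\ket\Omega=\bar c\ket\Omega$, and $\hat\psi_i(x)\ket\Omega=\hat\psi_i(x)^\dagger\ket\Omega=0$ for all $i\in\{2,\dots,n\}$.
   Context: $\mathcal{L}(\mathcal{D},\mathcal{H})$ denotes the linear maps from $\mathcal{D}$ into $\mathcal{H}$. $D^{(j_1,j_2)}$, for $j_1,j_2\in\{0,\tfrac12,1,\dots\}$, denotes the standard irreducible finite-dimensional representation of $SL(2,\mathbb{C})$ of dimension $(2j_1+1)(2j_2+1)$; $D^{(0,0)}$ is the one-dimensional trivial representation, so $n=1+(2j_1+1)(2j_2+1)$. *)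

theory Defs
  imports "HOL-Analysis.Analysis"
begin

text \<open>HOL has no class of complex vector spaces, so the complex scalar
multiplication sm and the inner product ip (antilinear in the first,
linear in the second argument, physics convention) are explicit parameters.\<close>

definition hnorm :: "('h \<Rightarrow> 'h \<Rightarrow> complex) \<Rightarrow> 'h \<Rightarrow> real" where
  "hnorm ip x = sqrt (Re (ip x x))"

definition hilbert_space ::
  "(complex \<Rightarrow> 'h::ab_group_add \<Rightarrow> 'h) \<Rightarrow> ('h \<Rightarrow> 'h \<Rightarrow> complex) \<Rightarrow> bool" where
  "hilbert_space sm ip \<longleftrightarrow>
     (\<forall>c x y. sm c (x + y) = sm c x + sm c y) \<and>
     (\<forall>c d x. sm (c + d) x = sm c x + sm d x) \<and>
     (\<forall>c d x. sm c (sm d x) = sm (c * d) x) \<and>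
     (\<forall>x. sm 1 x = x) \<and>
     (\<forall>x y z. ip x (y + z) = ip x y + ip x z) \<and>
     (\<forall>c x y. ip x (sm c y) = c * ip x y) \<and>
     (\<forall>x y. ip y x = cnj (ip x y)) \<and>
     (\<forall>x. Im (ip x x) = 0 \<and> Re (ip x x) \<ge> 0) \<and>
     (\<forall>x. ip x x = 0 \<longrightarrow> x = 0) \<and>
     (\<forall>X. (\<forall>e>0. \<exists>N. \<forall>m\<ge>N. \<forall>n\<ge>N. hnorm ip (X m - X n) < e)
          \<longrightarrow> (\<exists>l. (\<lambda>n. hnorm ip (X n - l)) \<longlonglongrightarrow> 0))"

definition dense_subspace ::
  "(complex \<Rightarrow> 'h::ab_group_add \<Rightarrow> 'h) \<Rightarrow> ('h \<Rightarrow> 'h \<Rightarrow> complex) \<Rightarrow> 'h set \<Rightarrow> bool" where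
  "dense_subspace sm ip D \<longleftrightarrow>
     0 \<in> D \<and> (\<forall>x\<in>D. \<forall>y\<in>D. x + y \<in> D) \<and> (\<forall>c. \<forall>x\<in>D. sm c x \<in> D) \<and>
     (\<forall>v. \<forall>e>0. \<exists>d\<in>D. hnorm ip (v - d) < e)"

text \<open>T is a linear map from the subspace D into H (an element of L(D,H));
only its values on D matter.\<close>
definition linear_on ::
  "(complex \<Rightarrow> 'h::ab_group_add \<Rightarrow> 'h) \<Rightarrow> 'h set \<Rightarrow> ('h \<Rightarrow> 'h) \<Rightarrow> bool" where
  "linear_on sm D T \<longleftrightarrow>
     (\<forall>x\<in>D. \<forall>y\<in>D. T (x + y) = T x + T y) \<and> (\<forall>c. \<forall>x\<in>D. T (sm c x) = sm c (T x))"

text \<open>Adjoint of an operator T with (dense) domain D: v is in the domain of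
T^dagger iff there is w with <w,u> = <v,T u> for all u in D; then T^dagger v = w
(unique by density of D).\<close>
definition in_adj_dom :: "('h \<Rightarrow> 'h \<Rightarrow> complex) \<Rightarrow> 'h set \<Rightarrow> ('h \<Rightarrow> 'h) \<Rightarrow> 'h \<Rightarrow> bool" where
  "in_adj_dom ip D T v \<longleftrightarrow> (\<exists>w. \<forall>u\<in>D. ip w u = ip v (T u))"

definition adj :: "('h \<Rightarrow> 'h \<Rightarrow> complex) \<Rightarrow> 'h set \<Rightarrow> ('h \<Rightarrow> 'h) \<Rightarrow> 'h \<Rightarrow> 'h" where
  "adj ip D T v = (THE w. \<forall>u\<in>D. ip w u = ip v (T u))"

definition unitary_op ::
  "(complex \<Rightarrow> 'h::ab_group_add \<Rightarrow> 'h) \<Rightarrow> ('h \<Rightarrow> 'h \<Rightarrow> complex) \<Rightarrow> ('h \<Rightarrow> 'h) \<Rightarrow> bool" where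
  "unitary_op sm ip T \<longleftrightarrow> linear_on sm UNIV T \<and> (\<forall>x y. ip (T x) (T y) = ip x y) \<and> surj T"

text \<open>Minkowski space = real^4 with coordinates x$0 (time), x$1, x$2, x$3.\<close>

definition SL2C :: "(complex^2^2) set" where
  "SL2C = {A. det A = 1}"

definition herm :: "real^4 \<Rightarrow> complex^2^2" where
  "herm x = (\<chi> i j.
     if i = 1 \<and> j = 1 then complex_of_real (x$0 + x$3)
     else if i = 1 \<and> j = 2 then Complex (x$1) (- x$2)
     else if i = 2 \<and> j = 1 then Complex (x$1) (x$2)
     else complex_of_real (x$0 - x$3))"

definition unherm :: "complex^2^2 \<Rightarrow> real^4" where
  "unherm Y = (\<chi> k.
     if k = 0 then Re (Y$1$1 + Y$2$2) / 2
     else if k = 1 then Re (Y$1$2 + Y$2$1) / 2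
     else if k = 2 then Im (Y$2$1 - Y$1$2) / 2
     else Re (Y$1$1 - Y$2$2) / 2)"

definition cadj :: "complex^2^2 \<Rightarrow> complex^2^2" where
  "cadj A = (\<chi> i j. cnj (A$j$i))"

definition Lam :: "complex^2^2 \<Rightarrow> real^4 \<Rightarrow> real^4" where
  "Lam A x = unherm (A ** herm x ** cadj A)"

definition Poincare :: "((real^4) \<times> (complex^2^2)) set" where
  "Poincare = UNIV \<times> SL2C"

definition pmult :: "(real^4) \<times> (complex^2^2) \<Rightarrow> (real^4) \<times> (complex^2^2) \<Rightarrow> (real^4) \<times> (complex^2^2)" where
  "pmult g h = (fst g + Lam (snd g) (fst h), snd g ** snd h)"

definition unitary_rep ::
  "(complex \<Rightarrow> 'h::ab_group_add \<Rightarrow> 'h) \<Rightarrow> ('h \<Rightarrow> 'h \<Rightarrow> complex)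
    \<Rightarrow> ((real^4) \<times> (complex^2^2) \<Rightarrow> 'h \<Rightarrow> 'h) \<Rightarrow> bool" where
  "unitary_rep sm ip U \<longleftrightarrow>
     (\<forall>g\<in>Poincare. unitary_op sm ip (U g)) \<and>
     U (0, mat 1) = id \<and>
     (\<forall>g\<in>Poincare. \<forall>h\<in>Poincare. U (pmult g h) = U g \<circ> U h)"

definition weakly_continuous ::
  "('h \<Rightarrow> 'h \<Rightarrow> complex) \<Rightarrow> ((real^4) \<times> (complex^2^2) \<Rightarrow> 'h \<Rightarrow> 'h) \<Rightarrow> bool" where
  "weakly_continuous ip U \<longleftrightarrow> (\<forall>v w. continuous_on Poincare (\<lambda>g. ip v (U g w)))"

text \<open>D^(j) for m = 2j: action (A.p)(z) = p(A^T z) on homogeneous polynomials of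
degree m in z1,z2, in the monomial basis e_k = z1^k z2^(m-k), k = 0..m.
Entry (l,k) is the coefficient of z1^l z2^(m-l) in (a z1 + c z2)^k (b z1 + d z2)^(m-k),
where A = [[a,b],[c,d]].\<close>
definition Dj :: "nat \<Rightarrow> complex^2^2 \<Rightarrow> nat \<Rightarrow> nat \<Rightarrow> complex" where
  "Dj m A l k = (\<Sum>r\<in>{0..min k l}.
      of_nat (k choose r) * of_nat ((m - k) choose (l - r)) *
      (A$1$1) ^ r * (A$2$1) ^ (k - r) * (A$1$2) ^ (l - r) * (A$2$2) ^ (m - k - (l - r)))"

text \<open>D^(j1,j2) = D^(j1) tensor conj(D^(j2)), with m1 = 2 j1, m2 = 2 j2, dimension
(m1+1)(m2+1); index p < (m1+1)(m2+1) corresponds to the pair (p div (m2+1), p mod (m2+1)).\<close>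
definition Djj :: "nat \<Rightarrow> nat \<Rightarrow> complex^2^2 \<Rightarrow> nat \<Rightarrow> nat \<Rightarrow> complex" where
  "Djj m1 m2 A p q = Dj m1 A (p div (m2 + 1)) (q div (m2 + 1)) *
                     cnj (Dj m2 A (p mod (m2 + 1)) (q mod (m2 + 1)))"

text \<open>S = D^(0,0) (+) D^(j1,j2) on C^n, indices 1..n, n = 1 + (m1+1)(m2+1):
index 1 is the trivial summand; indices 2..n carry D^(j1,j2), up to an arbitrary
change of basis M (N x N invertible, N = (m1+1)(m2+1)), i.e.
S[A]_(i,k) = (M D^(j1,j2)[A] M^-1)_(i-2,k-2) for i,k in 2..n.\<close>
definition is_S_rep :: "nat \<Rightarrow> nat \<Rightarrow> (complex^2^2 \<Rightarrow> nat \<Rightarrow> nat \<Rightarrow> complex) \<Rightarrow> bool" where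
  "is_S_rep m1 m2 S \<longleftrightarrow>
    (let N = (m1 + 1) * (m2 + 1); n = N + 1 in
     \<exists>M Mi :: nat \<Rightarrow> nat \<Rightarrow> complex.
       (\<forall>p<N. \<forall>q<N. (\<Sum>r<N. M p r * Mi r q) = (if p = q then 1 else 0)) \<and>
       (\<forall>p<N. \<forall>q<N. (\<Sum>r<N. Mi p r * M r q) = (if p = q then 1 else 0)) \<and>
       (\<forall>A\<in>SL2C.
          S A 1 1 = 1 \<and>
          (\<forall>i\<in>{2..n}. S A 1 i = 0 \<and> S A i 1 = 0) \<and>
          (\<forall>i\<in>{2..n}. \<forall>k\<in>{2..n}.
             S A i k = (\<Sum>p<N. \<Sum>q<N. M (i - 2) p * Djj m1 m2 A p q * Mi q (k - 2)))))"

end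

theory Submission
  imports Defs "HOL-Computational_Algebra.Polynomial"
begin

text \<open>
  By uniqueness, $\Omega$ is invariant under all $U(a,A)$ up to a phase, so for fixed $x$ the
  vectors $\hat\psi_\alpha(x)\Omega$ transform with $S$ under unitary operators. A nontrivial
  finite-dimensional representation of $SL(2,\mathbb{C})$ cannot act isometrically, which kills
  the components $i \ge 2$. The vector $\Psi = \hat\psi_1(0)\Omega$ is Lorentz invariant up to
  a phase, so $\langle\Psi, U(\xi)\Psi\rangle$ is a continuous Lorentz invariant function of
  $\xi$; boosts contract lightlike $\xi$ to 0, hence it is constant on the light cone and $\Psi$
  is invariant under all translations. The adjoint fields transform with the complex conjugate
  of $S$, and conjugating $D^{(j_1,j_2)}[A]$ amounts to conjugating the entries of $A$.
\<close>

section \<open>Identically vanishing polynomials in a complex variable and its conjugate\<close>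

lemma poly_eq_0_if_infinite_roots:
  fixes p :: "complex poly"
  assumes "infinite X" "\<And>x. x \<in> X \<Longrightarrow> poly p x = 0"
  shows "p = 0"
proof (rule ccontr)
  assume "p \<noteq> 0"
  then have "finite {x. poly p x = 0}" by (rule poly_roots_finite)
  moreover have "X \<subseteq> {x. poly p x = 0}" using assms(2) by auto
  ultimately show False using assms(1) finite_subset by blast
qed

lemma infinite_unit_circle: "infinite {w::complex. norm w = 1}"
proof -
  have "inj_on (\<lambda>x::real. Complex x (sqrt (1 - x\<^sup>2))) {0..1}"
    by (auto simp: inj_on_def)
  moreover have "infinite {0..1::real}" by (simp add: infinite_Icc)
  ultimately have "infinite ((\<lambda>x::real. Complex x (sqrt (1 - x\<^sup>2))) ` {0..1})"
    using finite_imageD by blast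
  moreover have "(\<lambda>x::real. Complex x (sqrt (1 - x\<^sup>2))) ` {0..1} \<subseteq> {w. norm w = 1}"
    by (auto simp: cmod_def power_le_one)
  ultimately show ?thesis using finite_subset by blast
qed

text \<open>Polar coordinates t = r w, with r real and |w| = 1, separate the exponents. For fixed w
  the sum is a polynomial in r, so its part of each total degree k vanishes. On the circle
  \<open>w ^ k * (w ^ e * cnj w ^ f) = w ^ (2 * e)\<close> for k = e + f, which leaves a polynomial
  in w with infinitely many roots.\<close>

lemma monomials_cnj_independent:
  fixes c :: "'q \<Rightarrow> complex" and e f :: "'q \<Rightarrow> nat"
  assumes fin: "finite Q"
    and inj: "inj_on (\<lambda>q. (e q, f q)) Q"
    and zero: "\<And>t. (\<Sum>q\<in>Q. c q * (t ^ e q * cnj t ^ f q)) = 0"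
    and q: "q \<in> Q"
  shows "c q = 0"
proof -
  define k where "k = e q + f q"
  define Qk where "Qk = {p \<in> Q. e p + f p = k}"
  define R where "R = (\<Sum>p\<in>Qk. monom (c p) (2 * e p))"
  have finQk: "finite Qk" using fin by (simp add: Qk_def)
  have "poly R w = 0" if w: "norm w = 1" for w
  proof -
    define P where "P = (\<Sum>p\<in>Q. monom (c p * (w ^ e p * cnj w ^ f p)) (e p + f p))"
    have "poly P (of_real r) = 0" for r
    proof -
      have "poly P (of_real r) =
          (\<Sum>p\<in>Q. c p * ((of_real r * w) ^ e p * cnj (of_real r * w) ^ f p))"
        unfolding P_def poly_sum
        by (intro sum.cong refl) (simp add: poly_monom power_mult_distrib power_add mult_ac)
      then show ?thesis using zero[of "of_real r * w"] by (simp only:)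
    qed
    moreover have "infinite (range complex_of_real)"
      by (meson finite_imageD infinite_UNIV_char_0 inj_of_real)
    ultimately have "P = 0" by (intro poly_eq_0_if_infinite_roots) auto
    then have "0 = w ^ k * coeff P k" by simp
    also have "\<dots> = w ^ k * (\<Sum>p\<in>Qk. c p * (w ^ e p * cnj w ^ f p))"
      unfolding P_def coeff_sum coeff_monom Qk_def
      using fin by (simp add: sum.If_cases Int_def if_distrib cong: if_cong)
    also have "\<dots> = (\<Sum>p\<in>Qk. c p * w ^ (2 * e p))"
      unfolding sum_distrib_left
    proof (intro sum.cong refl)
      fix p assume "p \<in> Qk"
      then have k: "k = e p + f p" by (simp add: Qk_def)
      have "w * cnj w = 1" using w by (simp add: complex_norm_square[symmetric])
      then have "w ^ f p * cnj w ^ f p = 1" by (metis power_mult_distrib power_one)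
      moreover have "w ^ k * (c p * (w ^ e p * cnj w ^ f p))
          = c p * w ^ (2 * e p) * (w ^ f p * cnj w ^ f p)"
        unfolding k mult_2 by (simp add: power_add mult_ac)
      ultimately show "w ^ k * (c p * (w ^ e p * cnj w ^ f p)) = c p * w ^ (2 * e p)" by simp
    qed
    finally show ?thesis by (simp add: R_def poly_sum poly_monom)
  qed
  then have "R = 0"
    using infinite_unit_circle by (intro poly_eq_0_if_infinite_roots) auto
  then have "0 = coeff R (2 * e q)" by simp
  \<comment> \<open>Within \<open>Qk\<close> the sum of the exponents is fixed, so
    \<open>e p = e q\<close> forces \<open>f p = f q\<close>, and injectivity gives p = q.\<close>
  also have "\<dots> = (\<Sum>p\<in>Qk. if p = q then c p else 0)"
    unfolding R_def coeff_sum coeff_monom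
    using inj q by (intro sum.cong refl) (auto simp: Qk_def k_def inj_on_def)
  also have "\<dots> = c q" using finQk q by (simp add: Qk_def k_def)
  finally show ?thesis by simp
qed

section \<open>The group SL(2,C) and complex conjugation of its representations\<close>

definition mat2 :: "complex \<Rightarrow> complex \<Rightarrow> complex \<Rightarrow> complex \<Rightarrow> complex^2^2" where
  "mat2 a b c d = vector [vector [a, b], vector [c, d]]"

lemma mat2_nth [simp]:
  "mat2 a b c d $ 1 $ 1 = a" "mat2 a b c d $ 1 $ 2 = b"
  "mat2 a b c d $ 2 $ 1 = c" "mat2 a b c d $ 2 $ 2 = d"
  by (simp_all add: mat2_def vector_2)

lemma mat2_in_SL2C: "mat2 a b c d \<in> SL2C \<longleftrightarrow> a * d - b * c = 1"
  by (simp add: SL2C_def det_2)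

lemma mat_1_in_SL2C: "mat 1 \<in> SL2C"
  by (simp add: SL2C_def)

text \<open>Inversion is an involution of the group, hence onto: the matrices S[A^{-1}] of the
  covariance law run through the whole image of S.\<close>

lemma matrix_inv_SL2C:
  assumes "A \<in> SL2C"
  shows "matrix_inv A \<in> SL2C" "matrix_inv (matrix_inv A) = A"
proof -
  have inverse: "B ** matrix_inv B = mat 1 \<and> matrix_inv B ** B = mat 1"
    if "B \<in> SL2C" for B
  proof -
    have "invertible B" using that by (simp add: SL2C_def invertible_det_nz)
    then show ?thesis unfolding matrix_inv_def invertible_def by (rule someI_ex)
  qed
  have "det A * det (matrix_inv A) = 1" by (metis inverse[OF assms] det_I det_mul)
  then show inv: "matrix_inv A \<in> SL2C" using assms by (simp add: SL2C_def)
  show "matrix_inv (matrix_inv A) = A"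
    by (metis inverse[OF assms] inverse[OF inv] matrix_mul_assoc matrix_mul_lid matrix_mul_rid)
qed

text \<open>Unlike \<open>cadj\<close> there is no transpose, so this is an automorphism of SL(2,C),
  not an antiautomorphism.\<close>

definition cnj_mat :: "complex^2^2 \<Rightarrow> complex^2^2" where
  "cnj_mat A = (\<chi> i j. cnj (A $ i $ j))"

lemma cnj_mat_nth [simp]: "cnj_mat A $ i $ j = cnj (A $ i $ j)"
  by (simp add: cnj_mat_def)

lemma cnj_mat_cnj_mat [simp]: "cnj_mat (cnj_mat A) = A"
  by (simp add: cnj_mat_def vec_eq_iff)

lemma cnj_mat_in_SL2C: "A \<in> SL2C \<Longrightarrow> cnj_mat A \<in> SL2C"
  by (simp add: SL2C_def det_2 flip: complex_cnj_mult complex_cnj_diff)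

lemma Djj_cnj_mat: "Djj m1 m2 (cnj_mat A) p q = cnj (Djj m1 m2 A p q)"
  by (simp add: Djj_def Dj_def)

text \<open>Row 0 holds the coefficients of z2^m, found by setting z1 = 0 and z2 = 1 in (a z1 + c
  z2)^k (b z1 + d z2)^(m-k).\<close>

lemma Dj_row_0: "Dj m A 0 k = (A$2$1) ^ k * (A$2$2) ^ (m - k)"
  by (simp add: Dj_def)

lemma is_S_repE:
  fixes N :: nat
  assumes "is_S_rep m1 m2 S" "N = (m1 + 1) * (m2 + 1)"
  obtains M Mi where
    "\<forall>p<N. \<forall>q<N. (\<Sum>r<N. M p r * Mi r q) = (if p = q then 1 else 0)"
    "\<forall>p<N. \<forall>q<N. (\<Sum>r<N. Mi p r * M r q) = (if p = q then 1 else 0)"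
    "\<forall>A\<in>SL2C. S A 1 1 = 1"
    "\<forall>A\<in>SL2C. \<forall>i\<in>{2..N + 1}. S A 1 i = 0"
    "\<forall>A\<in>SL2C. \<forall>i\<in>{2..N + 1}. S A i 1 = 0"
    "\<forall>A\<in>SL2C. \<forall>i\<in>{2..N + 1}. \<forall>k\<in>{2..N + 1}.
       S A i k = (\<Sum>p<N. \<Sum>q<N. M (i - 2) p * Djj m1 m2 A p q * Mi q (k - 2))"
  using assms(1) unfolding is_S_rep_def Let_def assms(2)[symmetric] ball_conj_distrib
  by (elim exE conjE) (rule that)

text \<open>The entries of \<open>Djj\<close> are integer polynomials in the entries of A and their
  conjugates, so conjugating the argument conjugates the value; M and Mi are conjugated too. Thus
  the conjugated coefficients of the adjoint fields are again of type (m1, m2), at a conjugated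
  argument.\<close>

lemma is_S_rep_cnj:
  assumes "is_S_rep m1 m2 S"
  shows "is_S_rep m1 m2 (\<lambda>A i k. cnj (S (cnj_mat A) i k))"
proof -
  define N where "N = (m1 + 1) * (m2 + 1)"
  obtain M Mi where
    M: "\<forall>p<N. \<forall>q<N. (\<Sum>r<N. M p r * Mi r q) = (if p = q then 1 else 0)"
    and Mi: "\<forall>p<N. \<forall>q<N. (\<Sum>r<N. Mi p r * M r q) = (if p = q then 1 else 0)"
    and S: "\<forall>A\<in>SL2C. S A 1 1 = 1"
    "\<forall>A\<in>SL2C. \<forall>i\<in>{2..N + 1}. S A 1 i = 0"
    "\<forall>A\<in>SL2C. \<forall>i\<in>{2..N + 1}. S A i 1 = 0"
    "\<forall>A\<in>SL2C. \<forall>i\<in>{2..N + 1}. \<forall>k\<in>{2..N + 1}.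
       S A i k = (\<Sum>p<N. \<Sum>q<N. M (i - 2) p * Djj m1 m2 A p q * Mi q (k - 2))"
    by (rule is_S_repE[OF assms N_def]) (rule that)
  show ?thesis
    unfolding is_S_rep_def Let_def N_def[symmetric]
  proof (rule exI[of _ "\<lambda>p q. cnj (M p q)"], rule exI[of _ "\<lambda>p q. cnj (Mi p q)"],
      intro conjI allI impI ballI)
    fix p q assume "p < N" "q < N"
    then show "(\<Sum>r<N. cnj (M p r) * cnj (Mi r q)) = (if p = q then 1 else 0)"
      and "(\<Sum>r<N. cnj (Mi p r) * cnj (M r q)) = (if p = q then 1 else 0)"
      using M[rule_format, of p q, THEN arg_cong, of cnj]
        Mi[rule_format, of p q, THEN arg_cong, of cnj] by simp_all
  next
    fix A :: "complex^2^2" and i k assume "A \<in> SL2C" and i: "i \<in> {2..N + 1}" and k: "k \<in> {2..N + 1}"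
    then have A: "cnj_mat A \<in> SL2C" by (simp only: cnj_mat_in_SL2C)
    show "cnj (S (cnj_mat A) i k)
        = (\<Sum>p<N. \<Sum>q<N. cnj (M (i - 2) p) * Djj m1 m2 A p q * cnj (Mi q (k - 2)))"
      unfolding S(4)[rule_format, OF A i k] by (simp add: Djj_cnj_mat)
  next
    fix A :: "complex^2^2" assume "A \<in> SL2C"
    then have A: "cnj_mat A \<in> SL2C" by (simp only: cnj_mat_in_SL2C)
    then show "cnj (S (cnj_mat A) 1 1) = 1" by (simp only: S(1) complex_cnj_one)
    fix i assume "i \<in> {2..N + 1}"
    then show "cnj (S (cnj_mat A) 1 i) = 0" "cnj (S (cnj_mat A) i 1) = 0"
      using A by (simp_all only: S(2,3) complex_cnj_zero)
  qed
qed

section \<open>Coordinates of Minkowski space and lightlike vectors\<close>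

lemma UNIV_4_eq: "(UNIV :: 4 set) = {0, 1, 2, 3}"
proof -
  \<comment> \<open>The index type is modulo 4; \<open>UNIV_4\<close> lists 1 to 4, while the
    coordinates are numbered 0 to 3.\<close>
  have "(4::4) = 0" by simp
  then show ?thesis using UNIV_4 by (metis insert_commute)
qed

lemma vec_4_eq_iff:
  "(x :: 'a^4) = y \<longleftrightarrow> x$0 = y$0 \<and> x$1 = y$1 \<and> x$2 = y$2 \<and> x$3 = y$3"
proof -
  have "(\<forall>i::4. P i) \<longleftrightarrow> P 0 \<and> P 1 \<and> P 2 \<and> P 3" for P
    using UNIV_4_eq by (metis UNIV_I empty_iff insert_iff)
  then show ?thesis by (simp add: vec_eq_iff)
qed

lemma unherm_nth:
  "unherm Y $ 0 = Re (Y$1$1 + Y$2$2) / 2" "unherm Y $ 1 = Re (Y$1$2 + Y$2$1) / 2"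
  "unherm Y $ 2 = Im (Y$2$1 - Y$1$2) / 2" "unherm Y $ 3 = Re (Y$1$1 - Y$2$2) / 2"
  by (simp_all add: unherm_def)

lemma herm_nth:
  "herm x $ 1 $ 1 = complex_of_real (x$0 + x$3)" "herm x $ 1 $ 2 = Complex (x$1) (- x$2)"
  "herm x $ 2 $ 1 = Complex (x$1) (x$2)" "herm x $ 2 $ 2 = complex_of_real (x$0 - x$3)"
  by (simp_all add: herm_def)

lemma Lam_mat_1: "Lam (mat 1) x = x"
proof -
  have "cadj (mat 1) = mat 1" by (simp add: cadj_def mat_def vec_eq_iff)
  then show ?thesis by (simp add: Lam_def vec_4_eq_iff unherm_nth herm_nth)
qed

lemma Lam_zero: "Lam A 0 = 0"
  by (simp add: Lam_def vec_4_eq_iff unherm_nth herm_nth matrix_matrix_mult_def cadj_def sum_2)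

text \<open>The vector with Hermitian matrix $s s^\dagger$, where $s$ is the spinor $(v, w)$.\<close>
definition lightlike :: "complex \<Rightarrow> complex \<Rightarrow> real^4" where
  "lightlike v w = unherm (mat2 (v * cnj v) (v * cnj w) (w * cnj v) (w * cnj w))"

text \<open>The action takes s s^dagger to (A s)(A s)^dagger, and A maps the spinor (1, 0) to its
  first column (a, c).\<close>

lemma Lam_lightlike:
  "Lam (mat2 a b c d) (s *\<^sub>R lightlike 1 0) = s *\<^sub>R lightlike a c"
  by (simp add: Lam_def lightlike_def vec_4_eq_iff unherm_nth herm_nth
      matrix_matrix_mult_def cadj_def sum_2 field_simps)

text \<open>\<open>lightlike 1 1\<close> is e0 + e1 and \<open>lightlike 1 \<i>\<close> is e0 + e2,
  which fixes two coefficients. The other two spinors give (e0 + e3)/2 and (e0 - e3)/2, which absorb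
  x$3 and the remaining time component x$0 - x$1 - x$2.\<close>

lemma lightlike_decomposition:
  "x = (x$0 + x$3 - x$1 - x$2) *\<^sub>R lightlike 1 0 + (x$0 - x$3 - x$1 - x$2) *\<^sub>R lightlike 0 1
     + x$1 *\<^sub>R lightlike 1 1 + x$2 *\<^sub>R lightlike 1 \<i>"
  by (simp add: lightlike_def vec_4_eq_iff unherm_nth field_simps)

section \<open>Inner products, adjoints and isometric actions\<close>

locale complex_hilbert =
  fixes sm :: "complex \<Rightarrow> 'h::ab_group_add \<Rightarrow> 'h" and ip :: "'h \<Rightarrow> 'h \<Rightarrow> complex"
  assumes hilbert: "hilbert_space sm ip"
begin

sublocale vector_space sm
proof -
  have "\<forall>c x y. sm c (x + y) = sm c x + sm c y"
    and "\<forall>c d x. sm (c + d) x = sm c x + sm d x"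
    and "\<forall>c d x. sm c (sm d x) = sm (c * d) x"
    and "\<forall>x. sm 1 x = x"
    using hilbert unfolding hilbert_space_def by - (elim conjE, assumption)+
  then show "vector_space sm" by unfold_locales simp_all
qed

lemma ip_add_right [rule_format]: "\<forall>x y z. ip x (y + z) = ip x y + ip x z"
  using hilbert unfolding hilbert_space_def by (elim conjE)

lemma ip_scale_right [rule_format]: "\<forall>c x y. ip x (sm c y) = c * ip x y"
  using hilbert unfolding hilbert_space_def by (elim conjE)

lemma ip_commute [rule_format]: "\<forall>x y. ip y x = cnj (ip x y)"
  using hilbert unfolding hilbert_space_def by (elim conjE)

lemma ip_self [rule_format]: "\<forall>x. Im (ip x x) = 0 \<and> Re (ip x x) \<ge> 0"
  using hilbert unfolding hilbert_space_def by (elim conjE)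

lemma ip_self_eq_0 [rule_format]: "\<forall>x. ip x x = 0 \<longrightarrow> x = 0"
  using hilbert unfolding hilbert_space_def by (elim conjE)

lemma ip_add_left: "ip (y + z) x = ip y x + ip z x"
  by (metis complex_cnj_add ip_add_right ip_commute)

lemma ip_scale_left: "ip (sm c y) x = cnj c * ip y x"
  by (metis complex_cnj_mult ip_commute ip_scale_right)

lemma ip_zero_right [simp]: "ip x 0 = 0"
  using ip_scale_right[of x 0 0] by simp

lemma ip_zero_left [simp]: "ip 0 x = 0"
  using ip_scale_left[of 0 0 x] by simp

lemma ip_minus_right: "ip x (- y) = - ip x y"
  using ip_scale_right[of x "-1" y] by simp

lemma ip_minus_left: "ip (- y) x = - ip y x"
  using ip_scale_left[of "-1" y x] by simp

lemma ip_diff_right: "ip x (y - z) = ip x y - ip x z"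
  using ip_add_right[of x y "- z"] by (simp add: ip_minus_right)

lemma ip_diff_left: "ip (y - z) x = ip y x - ip z x"
  using ip_add_left[of y "- z" x] by (simp add: ip_minus_left)

lemma ip_sum_right: "ip x (\<Sum>i\<in>I. f i) = (\<Sum>i\<in>I. ip x (f i))"
  by (induction I rule: infinite_finite_induct) (simp_all add: ip_add_right)

lemma ip_sum_left: "ip (\<Sum>i\<in>I. f i) x = (\<Sum>i\<in>I. ip (f i) x)"
  by (induction I rule: infinite_finite_induct) (simp_all add: ip_add_left)

lemma eq_if_ip_right_eq: "(\<And>w. ip w x = ip w y) \<Longrightarrow> x = y"
  using ip_self_eq_0[of "x - y"] by (simp add: ip_diff_right)

text \<open>The difference z is orthogonal to D, so |z - d|^2 = |z|^2 + |d|^2 for d in D. No d comes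
  closer to z than |z|, which contradicts density unless z = 0.\<close>

lemma eq_if_ip_left_eq_on_dense:
  assumes D: "dense_subspace sm ip D" and eq: "\<And>u. u \<in> D \<Longrightarrow> ip v u = ip w u"
  shows "v = w"
proof -
  define z where "z = v - w"
  have orth: "ip z u = 0" "ip u z = 0" if "u \<in> D" for u
  proof -
    show "ip z u = 0" using eq[OF that] by (simp add: z_def ip_diff_left)
    then show "ip u z = 0" by (metis complex_cnj_zero ip_commute)
  qed
  have "ip z z = 0"
  proof (rule ccontr)
    assume "ip z z \<noteq> 0"
    then have pos: "Re (ip z z) > 0"
      using ip_self[of z] by (auto simp: complex_eq_iff)
    then obtain d where d: "d \<in> D" "hnorm ip (z - d) < sqrt (Re (ip z z))"
      using D unfolding dense_subspace_def by (meson real_sqrt_gt_zero)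
    have "ip (z - d) (z - d) = ip z z + ip d d"
      using orth[OF d(1)] by (simp add: ip_diff_left ip_diff_right)
    then show False using d(2) ip_self[of d] by (simp add: hnorm_def)
  qed
  then show ?thesis using ip_self_eq_0[of z] by (simp add: z_def)
qed

text \<open>Density makes the vector described by \<open>adj\<close> unique, so exhibiting one is
  enough.\<close>

lemma adj_eqI:
  assumes "dense_subspace sm ip D" "\<And>u. u \<in> D \<Longrightarrow> ip w u = ip v (T u)"
  shows "adj ip D T v = w"
  unfolding adj_def
proof (rule the_equality)
  show "\<forall>u\<in>D. ip w u = ip v (T u)" using assms(2) by blast
  show "w' = w" if "\<forall>u\<in>D. ip w' u = ip v (T u)" for w'
    using assms(2) that by (intro eq_if_ip_left_eq_on_dense[OF assms(1)]) simp
qed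

lemma ip_adj_left:
  assumes D: "dense_subspace sm ip D" and v: "in_adj_dom ip D T v" and u: "u \<in> D"
  shows "ip (adj ip D T v) u = ip v (T u)"
proof -
  obtain w where w: "\<And>u. u \<in> D \<Longrightarrow> ip w u = ip v (T u)"
    using v unfolding in_adj_dom_def by blast
  then show ?thesis using adj_eqI[OF D w] u by simp
qed

lemma dense_subspace_UNIV: "dense_subspace sm ip UNIV"
proof -
  have "hnorm ip (v - v) < e" if "e > 0" for v e using that by (simp add: hnorm_def)
  then show ?thesis unfolding dense_subspace_def by blast
qed

text \<open>The row of index 0 of $D^{(j_1,j_2)}[A]$ depends only on the second row $(c, d)$ of $A$.
With $c = 0$ it shows that the vector of index 0 is an eigenvector of a boost with eigenvalue
of modulus $\neq 1$, so it vanishes; then with $d = 1$ it gives a polynomial in $c$ and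
$\bar c$ that vanishes identically and has all the vectors as coefficients.\<close>
lemma isometric_S_rep_vectors_eq_0:
  fixes \<Psi> :: "nat \<Rightarrow> 'h"
  assumes jj: "(m1, m2) \<noteq> (0, 0)"
    and n: "n = 1 + (m1 + 1) * (m2 + 1)"
    and S: "is_S_rep m1 m2 S"
    and W: "\<And>A. A \<in> SL2C \<Longrightarrow> \<exists>W. linear_on sm UNIV W \<and> (\<forall>v. ip (W v) (W v) = ip v v) \<and>
      (\<forall>\<alpha>\<in>{1..n}. W (\<Psi> \<alpha>) = (\<Sum>\<beta>\<in>{1..n}. sm (S A \<alpha> \<beta>) (\<Psi> \<beta>)))"
    and i: "i \<in> {2..n}"
  shows "\<Psi> i = 0"
proof -
  define N where "N = (m1 + 1) * (m2 + 1)"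
  have nN: "n = N + 1" and N0: "0 < N" by (simp_all add: n N_def)
  obtain M Mi where
    M: "\<forall>p<N. \<forall>q<N. (\<Sum>r<N. M p r * Mi r q) = (if p = q then 1 else 0)"
    and Mi: "\<forall>p<N. \<forall>q<N. (\<Sum>r<N. Mi p r * M r q) = (if p = q then 1 else 0)"
    and S': "\<forall>A\<in>SL2C. \<forall>i\<in>{2..N + 1}. S A i 1 = 0"
      "\<forall>A\<in>SL2C. \<forall>i\<in>{2..N + 1}. \<forall>k\<in>{2..N + 1}.
       S A i k = (\<Sum>p<N. \<Sum>q<N. M (i - 2) p * Djj m1 m2 A p q * Mi q (k - 2))"
    by (rule is_S_repE[OF S N_def]) (rule that)
  \<comment> \<open>Undoing the basis change gives vectors that transform directly with
    \<open>Djj\<close>; the shift by 2 aligns the indices 2..n with 0..N-1.\<close>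
  define \<Phi> where "\<Phi> p = (\<Sum>r<N. sm (Mi p r) (\<Psi> (r + 2)))" for p
  have W\<Phi>: "\<exists>W. W 0 = 0 \<and> (\<forall>v. ip (W v) (W v) = ip v v) \<and>
      W (\<Phi> 0) = (\<Sum>q<N. sm (Djj m1 m2 A 0 q) (\<Phi> q))" if A: "A \<in> SL2C" for A
  proof -
    obtain W where lin: "linear_on sm UNIV W" and iso: "\<And>v. ip (W v) (W v) = ip v v"
      and act: "\<And>\<alpha>. \<alpha> \<in> {1..n} \<Longrightarrow> W (\<Psi> \<alpha>) = (\<Sum>\<beta>\<in>{1..n}. sm (S A \<alpha> \<beta>) (\<Psi> \<beta>))"
      using W[OF A] by blast
    have W0: "W 0 = 0" using iso[of 0] ip_self_eq_0 by simp
    have Wsm: "W (sm c v) = sm c (W v)" for c v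
      using lin by (simp add: linear_on_def)
    have Wsum: "W (\<Sum>r\<in>I. f r) = (\<Sum>r\<in>I. W (f r))" for I and f :: "nat \<Rightarrow> 'h"
      using lin W0 by (induction I rule: infinite_finite_induct) (simp_all add: linear_on_def)
    have act2: "W (\<Psi> (r + 2)) = (\<Sum>p<N. sm (M r p) (\<Sum>q<N. sm (Djj m1 m2 A p q) (\<Phi> q)))"
      if r: "r < N" for r
    proof -
      have "W (\<Psi> (r + 2)) = (\<Sum>\<beta>\<in>{1..n}. sm (S A (r + 2) \<beta>) (\<Psi> \<beta>))"
        using r by (intro act) (simp add: nN)
      also have "{1..n} = insert 1 {2..n}" using nN by auto
      also have "(\<Sum>\<beta>\<in>insert 1 {2..n}. sm (S A (r + 2) \<beta>) (\<Psi> \<beta>))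
          = (\<Sum>\<beta>\<in>{2..n}. sm (S A (r + 2) \<beta>) (\<Psi> \<beta>))"
        using S'(1)[rule_format, OF A, of "r + 2"] r by simp
      also have "\<dots> = (\<Sum>k<N. sm (S A (r + 2) (k + 2)) (\<Psi> (k + 2)))"
        by (rule sum.reindex_bij_witness[of _ "\<lambda>k. k + 2" "\<lambda>k. k - 2"])
           (auto simp: nN simp del: add_2_eq_Suc')
      also have "\<dots> = (\<Sum>k<N. \<Sum>p<N. \<Sum>q<N. sm (M r p * Djj m1 m2 A p q * Mi q k) (\<Psi> (k + 2)))"
        using S'(2)[rule_format, OF A] r by (intro sum.cong refl) (simp add: scale_sum_left)
      also have "\<dots> = (\<Sum>p<N. \<Sum>k<N. \<Sum>q<N. sm (M r p * Djj m1 m2 A p q * Mi q k) (\<Psi> (k + 2)))"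
        by (rule sum.swap)
      also have "\<dots> = (\<Sum>p<N. \<Sum>q<N. \<Sum>k<N. sm (M r p * Djj m1 m2 A p q * Mi q k) (\<Psi> (k + 2)))"
        by (intro sum.cong refl sum.swap)
      finally show ?thesis by (simp add: \<Phi>_def scale_sum_right mult.assoc)
    qed
    have "W (\<Phi> 0) = (\<Sum>r<N. sm (Mi 0 r) (W (\<Psi> (r + 2))))"
      by (simp add: \<Phi>_def Wsum Wsm)
    also have "\<dots> = (\<Sum>r<N. \<Sum>p<N. sm (Mi 0 r * M r p) (\<Sum>q<N. sm (Djj m1 m2 A p q) (\<Phi> q)))"
      by (intro sum.cong refl) (simp only: act2 lessThan_iff scale_sum_right scale_scale mult.assoc)
    also have "\<dots> = (\<Sum>p<N. \<Sum>r<N. sm (Mi 0 r * M r p) (\<Sum>q<N. sm (Djj m1 m2 A p q) (\<Phi> q)))"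
      by (rule sum.swap)
    also have "\<dots> = (\<Sum>p<N. if p = 0 then \<Sum>q<N. sm (Djj m1 m2 A p q) (\<Phi> q) else 0)"
      using Mi[rule_format, OF N0] by (intro sum.cong refl) (simp add: scale_sum_left[symmetric])
    also have "\<dots> = (\<Sum>q<N. sm (Djj m1 m2 A 0 q) (\<Phi> q))"
      using N0 by simp
    finally show ?thesis using W0 iso by blast
  qed
  have \<Phi>0: "\<Phi> 0 = 0"
  proof -
    \<comment> \<open>Here c = 0 and d = 2. Since 0 ^ 0 = 1, the row has the single nonzero entry 2
      ^ (m1 + m2), at q = 0.\<close>
    define A where "A = mat2 (1/2) 0 0 2"
    have A: "A \<in> SL2C" by (simp add: A_def mat2_in_SL2C)
    have row: "Djj m1 m2 A 0 q = (if q = 0 then 2 ^ (m1 + m2) else 0)" for q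
    proof (cases "q = 0")
      case False
      then have "q div (m2 + 1) \<noteq> 0 \<or> q mod (m2 + 1) \<noteq> 0"
        by (metis div_mult_mod_eq mult_0 add_0)
      then show ?thesis using False by (auto simp: Djj_def Dj_row_0 A_def)
    qed (simp add: Djj_def Dj_row_0 A_def power_add)
    obtain W where iso: "\<And>v. ip (W v) (W v) = ip v v"
      and act: "W (\<Phi> 0) = (\<Sum>q<N. sm (Djj m1 m2 A 0 q) (\<Phi> q))"
      using W\<Phi>[OF A] by blast
    have "W (\<Phi> 0) = (\<Sum>q<N. if q = 0 then sm (2 ^ (m1 + m2)) (\<Phi> q) else 0)"
      unfolding act row by (intro sum.cong) auto
    then have "W (\<Phi> 0) = sm (2 ^ (m1 + m2)) (\<Phi> 0)" using N0 by simp
    then have "2 ^ (m1 + m2) * 2 ^ (m1 + m2) * ip (\<Phi> 0) (\<Phi> 0) = ip (\<Phi> 0) (\<Phi> 0)"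
      using iso[of "\<Phi> 0"] by (simp add: ip_scale_left ip_scale_right)
    \<comment> \<open>Nontriviality of the representation enters here, as positivity of the
      exponent.\<close>
    moreover have "(2::complex) ^ (m1 + m2) * 2 ^ (m1 + m2) \<noteq> 1"
    proof
      assume "(2::complex) ^ (m1 + m2) * 2 ^ (m1 + m2) = 1"
      then have "norm ((2::complex) ^ (m1 + m2 + (m1 + m2))) = 1"
        by (simp only: power_add norm_one)
      then have "(2::real) ^ (m1 + m2 + (m1 + m2)) = 1" by (simp add: norm_power)
      moreover have "(2::real) ^ (m1 + m2 + (m1 + m2)) > 1"
        using jj by (intro one_less_power) auto
      ultimately show False by simp
    qed
    ultimately show ?thesis using ip_self_eq_0 by simp
  qed
  have \<Phi>: "\<Phi> q = 0" if q: "q < N" for q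
  proof (rule eq_if_ip_right_eq)
    fix w
    \<comment> \<open>Pairing with w turns the vector identity into a scalar polynomial identity
      with coefficients \<open>ip w (\<Phi> q)\<close>.\<close>
    have "ip w (\<Phi> q) = 0"
    proof (rule monomials_cnj_independent[where Q = "{..<N}"])
      show "inj_on (\<lambda>q. (q div (m2 + 1), q mod (m2 + 1))) {..<N}"
        by (rule inj_onI) (metis div_mult_mod_eq prod.inject)
      show "(\<Sum>q<N. ip w (\<Phi> q) * (t ^ (q div (m2 + 1)) * cnj t ^ (q mod (m2 + 1)))) = 0" for t
      proof -
        \<comment> \<open>With c = t and d = 1, entry q of row 0 is exactly the monomial in t and
          \<open>cnj t\<close>; the left side of the action is \<open>W 0 = 0\<close>.\<close>
        define A where "A = mat2 1 0 t 1"
        have A: "A \<in> SL2C" by (simp add: A_def mat2_in_SL2C)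
        obtain W where "W 0 = 0" and act: "W (\<Phi> 0) = (\<Sum>q<N. sm (Djj m1 m2 A 0 q) (\<Phi> q))"
          using W\<Phi>[OF A] by blast
        then have "0 = ip w (\<Sum>q<N. sm (Djj m1 m2 A 0 q) (\<Phi> q))" using \<Phi>0 by simp
        then show ?thesis
          by (simp add: ip_sum_right ip_scale_right Djj_def Dj_row_0 A_def mult.commute)
      qed
    qed (use q in auto)
    then show "ip w (\<Phi> q) = ip w 0" by simp
  qed
  define r where "r = i - 2"
  have r: "r < N" "i = r + 2" using i by (auto simp: r_def nN)
  \<comment> \<open>Applying \<open>M\<close> recovers the original vectors from
    \<open>\<Phi>\<close>.\<close>
  have "0 = (\<Sum>p<N. sm (M r p) (\<Phi> p))" using \<Phi> by simp
  also have "\<dots> = (\<Sum>p<N. \<Sum>k<N. sm (M r p * Mi p k) (\<Psi> (k + 2)))"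
    by (simp add: \<Phi>_def scale_sum_right)
  also have "\<dots> = (\<Sum>k<N. \<Sum>p<N. sm (M r p * Mi p k) (\<Psi> (k + 2)))"
    by (rule sum.swap)
  also have "\<dots> = (\<Sum>k<N. if r = k then \<Psi> (k + 2) else 0)"
    using M[rule_format, OF r(1)] by (intro sum.cong refl) (simp add: scale_sum_left[symmetric])
  also have "\<dots> = \<Psi> i" using r by simp
  finally show ?thesis by simp
qed

end

section \<open>Unitary Poincare representations with a unique vacuum\<close>

locale poincare_vacuum = complex_hilbert sm ip
  for sm :: "complex \<Rightarrow> 'h::ab_group_add \<Rightarrow> 'h" and ip :: "'h \<Rightarrow> 'h \<Rightarrow> complex" +
  fixes D :: "'h set" and U :: "(real^4) \<times> (complex^2^2) \<Rightarrow> 'h \<Rightarrow> 'h" and \<Omega> :: 'h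
  assumes Urep: "unitary_rep sm ip U"
    and continuous: "weakly_continuous ip U"
    and U_dom: "\<forall>g\<in>Poincare. U g ` D \<subseteq> D \<and> adj ip UNIV (U g) ` D \<subseteq> D"
    and vacuum: "\<Omega> \<in> D" "\<Omega> \<noteq> 0" "\<forall>x. U (x, mat 1) \<Omega> = \<Omega>"
    and vacuum_unique: "\<forall>\<Phi>\<in>D. (\<forall>x. U (x, mat 1) \<Phi> = \<Phi>) \<longrightarrow> (\<exists>c. \<Phi> = sm c \<Omega>)"
begin

lemma U_scale: "g \<in> Poincare \<Longrightarrow> U g (sm c v) = sm c (U g v)"
  and U_add: "g \<in> Poincare \<Longrightarrow> U g (v + w) = U g v + U g w"
  and U_isometric: "g \<in> Poincare \<Longrightarrow> ip (U g v) (U g w) = ip v w"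
  and U_surj: "g \<in> Poincare \<Longrightarrow> surj (U g)"
  and U_mult: "g \<in> Poincare \<Longrightarrow> h \<in> Poincare \<Longrightarrow> U (pmult g h) v = U g (U h v)"
  and U_one: "U (0, mat 1) v = v"
  using Urep unfolding unitary_rep_def unitary_op_def linear_on_def by auto

lemma U_inject: "g \<in> Poincare \<Longrightarrow> U g v = U g w \<Longrightarrow> v = w"
  by (metis U_isometric U_surj eq_if_ip_right_eq)

lemma in_Poincare: "A \<in> SL2C \<Longrightarrow> (a, A) \<in> Poincare"
  by (simp add: Poincare_def)

lemma adj_U:
  assumes "g \<in> Poincare" shows "adj ip UNIV (U g) (U g v) = v"
  using assms by (intro adj_eqI dense_subspace_UNIV) (simp add: U_isometric)

lemma U_adj:
  assumes "g \<in> Poincare" shows "U g (adj ip UNIV (U g) v) = v"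
proof -
  obtain w where "v = U g w" using U_surj[OF assms] by (meson surjE)
  then show ?thesis using adj_U[OF assms] by simp
qed

lemma U_translation_add: "U (x + y, mat 1) v = U (x, mat 1) (U (y, mat 1) v)"
  using U_mult[OF in_Poincare in_Poincare, OF mat_1_in_SL2C mat_1_in_SL2C, of x y v]
  by (simp add: pmult_def Lam_mat_1)

lemma U_translation_conjugate:
  assumes "A \<in> SL2C"
  shows "U (a, A) (U (x, mat 1) v) = U (Lam A x, mat 1) (U (a, A) v)"
proof -
  have "pmult (a, A) (x, mat 1) = pmult (Lam A x, mat 1) (a, A)"
    by (simp add: pmult_def Lam_mat_1)
  then show ?thesis using U_mult in_Poincare assms mat_1_in_SL2C by metis
qed

text \<open>Translations form a normal subgroup, so this vector is again translation invariant; it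
  lies in D, uniqueness makes it a multiple of \<Omega>, and unitarity makes the factor a phase. The
  adjoint is used because the covariance law applies the field to it.\<close>

lemma adj_U_vacuum:
  assumes A: "A \<in> SL2C"
  obtains \<kappa> where "cnj \<kappa> * \<kappa> = 1" "adj ip UNIV (U (a, A)) \<Omega> = sm \<kappa> \<Omega>"
proof -
  let ?w = "adj ip UNIV (U (a, A)) \<Omega>"
  note g = in_Poincare[OF A]
  have "U (x, mat 1) ?w = ?w" for x
  proof (rule U_inject[OF g[of a]])
    show "U (a, A) (U (x, mat 1) ?w) = U (a, A) ?w"
      using U_translation_conjugate[OF A] U_adj[OF g] vacuum(3) by simp
  qed
  moreover have "?w \<in> D" using U_dom g vacuum(1) by blast
  ultimately obtain \<kappa> where \<kappa>: "?w = sm \<kappa> \<Omega>" using vacuum_unique by blast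
  have "ip ?w ?w = ip \<Omega> \<Omega>" by (metis U_isometric[OF g] U_adj[OF g])
  then have "cnj \<kappa> * \<kappa> * ip \<Omega> \<Omega> = ip \<Omega> \<Omega>"
    by (simp add: \<kappa> ip_scale_left ip_scale_right mult_ac)
  moreover have "ip \<Omega> \<Omega> \<noteq> 0" using vacuum(2) ip_self_eq_0 by blast
  ultimately have "cnj \<kappa> * \<kappa> = 1" by simp
  then show thesis using \<kappa> that by blast
qed

text \<open>A boost contracts a lightlike vector to 0, so weak continuity at 0 forces
$\langle\Psi, U(\xi)\Psi\rangle = \langle\Psi, \Psi\rangle$ for lightlike $\xi$;
the lightlike vectors span spacetime.\<close>
lemma Lorentz_invariant_imp_translation_invariant:
  assumes inv: "\<And>A. A \<in> SL2C \<Longrightarrow> \<exists>\<kappa>. cnj \<kappa> * \<kappa> = 1 \<and> U (0, A) \<Psi> = sm \<kappa> \<Psi>"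
  shows "U (x, mat 1) \<Psi> = \<Psi>"
proof -
  define F where "F x = ip \<Psi> (U (x, mat 1) \<Psi>)" for x
  have T: "(x, mat 1) \<in> Poincare" for x by (simp add: in_Poincare mat_1_in_SL2C)
  \<comment> \<open>The phase occurs once plain and once conjugated, so it cancels.\<close>
  have F_Lam: "F (Lam A x) = F x" if A: "A \<in> SL2C" for A x
  proof -
    obtain \<kappa> where \<kappa>: "cnj \<kappa> * \<kappa> = 1" "U (0, A) \<Psi> = sm \<kappa> \<Psi>" using inv[OF A] by blast
    have "F x = ip (U (0, A) \<Psi>) (U (0, A) (U (x, mat 1) \<Psi>))"
      by (simp add: F_def U_isometric in_Poincare A)
    also have "\<dots> = cnj \<kappa> * \<kappa> * F (Lam A x)"
      by (simp add: U_translation_conjugate A \<kappa>(2) U_scale T ip_scale_left ip_scale_right F_def)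
    finally show ?thesis using \<kappa>(1) by simp
  qed
  have F0: "F 0 = ip \<Psi> \<Psi>" by (simp add: F_def U_one)
  \<comment> \<open>Equality case of Cauchy-Schwarz for two vectors of the same norm.\<close>
  have invariant: "U (x, mat 1) \<Psi> = \<Psi>" if "F x = F 0" for x
  proof -
    have 1: "ip \<Psi> (U (x, mat 1) \<Psi>) = ip \<Psi> \<Psi>" using that F0 by (simp add: F_def)
    then have 2: "ip (U (x, mat 1) \<Psi>) \<Psi> = ip \<Psi> \<Psi>" by (metis ip_commute)
    have "ip (U (x, mat 1) \<Psi> - \<Psi>) (U (x, mat 1) \<Psi> - \<Psi>) = 0"
      by (simp add: ip_diff_left ip_diff_right 1 2 U_isometric T)
    then show ?thesis using ip_self_eq_0 by fastforce
  qed
  have F_e: "F (s *\<^sub>R lightlike 1 0) = F 0" for s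
  proof -
    \<comment> \<open>A boost along the third axis: the spinor (1, 0) becomes (1/2, 0), so its
      lightlike vector shrinks by 1/4.\<close>
    define B where "B = mat2 (1/2) 0 0 2"
    have B: "B \<in> SL2C" by (simp add: B_def mat2_in_SL2C)
    have boost: "Lam B (r *\<^sub>R lightlike 1 0) = (r / 4) *\<^sub>R lightlike 1 0" for r
      unfolding B_def Lam_lightlike
      by (simp add: lightlike_def vec_4_eq_iff unherm_nth)
    have const: "F ((s * (1/4) ^ k) *\<^sub>R lightlike 1 0) = F (s *\<^sub>R lightlike 1 0)" for k
    proof (induction k)
      case (Suc k)
      then show ?case
        using F_Lam[OF B, of "(s * (1/4) ^ k) *\<^sub>R lightlike 1 0"] unfolding boost by simp
    qed simp
    have "(\<lambda>k. (s * (1/4) ^ k) *\<^sub>R lightlike 1 0) \<longlonglongrightarrow> (s * 0) *\<^sub>R lightlike 1 0"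
      by (intro tendsto_intros LIMSEQ_power_zero) simp
    then have lim: "(\<lambda>k. ((s * (1/4) ^ k) *\<^sub>R lightlike 1 0, mat 1 :: complex^2^2)) \<longlonglongrightarrow> (0, mat 1)"
      by (intro tendsto_Pair) auto
    have "continuous_on Poincare (\<lambda>g. ip \<Psi> (U g \<Psi>))"
      using continuous by (simp add: weakly_continuous_def)
    then have "(\<lambda>k. F ((s * (1/4) ^ k) *\<^sub>R lightlike 1 0)) \<longlonglongrightarrow> F 0"
      unfolding F_def by (rule continuous_on_tendsto_compose[OF _ lim T]) (simp only: T eventually_True)
    then show ?thesis unfolding const by (simp add: LIMSEQ_const_iff)
  qed
  \<comment> \<open>The spinor (a, c) is the first column of an SL(2,C) matrix, so its lightlike
    vector is a Lorentz image of the one for (1, 0), with the same value of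
    \<open>F\<close>.\<close>
  have light: "U (s *\<^sub>R lightlike a c, mat 1) \<Psi> = \<Psi>" if "a * d - b * c = 1" for s a b c d
    using F_Lam[of "mat2 a b c d" "s *\<^sub>R lightlike 1 0"] that
    by (intro invariant) (simp add: Lam_lightlike mat2_in_SL2C F_e)
  have "U (p *\<^sub>R lightlike 1 0 + q *\<^sub>R lightlike 0 1
      + r *\<^sub>R lightlike 1 1 + s *\<^sub>R lightlike 1 \<i>, mat 1) \<Psi> = \<Psi>" for p q r s
    \<comment> \<open>The instances supply a, d, b, c in this order: matrices with first columns (1,
      0), (0, 1), (1, 1) and (1, \<i>).\<close>
    by (simp add: U_translation_add light[of 1 1 0 0] light[of 0 0 "-1" 1]
        light[of 1 1 0 1] light[of 1 1 0 \<i>])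
  then show ?thesis by (subst lightlike_decomposition[of x])
qed

text \<open>Abstracting the group argument to \<sigma> covers both the fields, with \<sigma> the
  inversion, and their adjoints, with \<sigma> inversion followed by conjugation.\<close>

lemma covariant_family_vacuum:
  assumes jj: "(m1, m2) \<noteq> (0, 0)"
    and n: "n = 1 + (m1 + 1) * (m2 + 1)"
    and S: "is_S_rep m1 m2 S"
    and \<sigma>: "\<sigma> ` SL2C = SL2C"
    and scale: "\<And>\<alpha> x c. \<alpha> \<in> {1..n} \<Longrightarrow> phi \<alpha> x (sm c \<Omega>) = sm c (phi \<alpha> x \<Omega>)"
    and dom: "\<And>\<alpha> x. \<alpha> \<in> {1..n} \<Longrightarrow> phi \<alpha> x \<Omega> \<in> D"
    and cov: "\<And>a A x \<alpha>. A \<in> SL2C \<Longrightarrow> \<alpha> \<in> {1..n} \<Longrightarrow>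
      U (a, A) (phi \<alpha> x (adj ip UNIV (U (a, A)) \<Omega>)) =
        (\<Sum>\<beta>\<in>{1..n}. sm (S (\<sigma> A) \<alpha> \<beta>) (phi \<beta> (Lam A x + a) \<Omega>))"
  obtains c where "\<And>x. phi 1 x \<Omega> = sm c \<Omega>"
    "\<And>x i. i \<in> {2..n} \<Longrightarrow> phi i x \<Omega> = 0"
proof -
  have \<sigma>_in: "\<sigma> A \<in> SL2C" if "A \<in> SL2C" for A using \<sigma> that by blast
  have cov1: "U (a, A) (phi 1 x (adj ip UNIV (U (a, A)) \<Omega>)) = phi 1 (Lam A x + a) \<Omega>"
    if A: "A \<in> SL2C" for a A x
  proof -
    have S1: "S (\<sigma> A) 1 1 = 1" "\<And>i. i \<in> {2..n} \<Longrightarrow> S (\<sigma> A) 1 i = 0"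
      using S \<sigma>_in[OF A] unfolding is_S_rep_def Let_def n by (auto simp: add.commute)
    have "{1..n} = insert 1 {2..n}" using n by auto
    then have "(\<Sum>\<beta>\<in>{1..n}. sm (S (\<sigma> A) 1 \<beta>) (phi \<beta> (Lam A x + a) \<Omega>))
        = phi 1 (Lam A x + a) \<Omega>"
      using S1 by simp
    then show ?thesis using cov[OF A, of 1] n by simp
  qed
  \<comment> \<open>Lorentz transformations fix the origin, so the invariant component at x = 0
    gives a vector fixed up to a phase.\<close>
  have "U (y, mat 1) (phi 1 0 \<Omega>) = phi 1 0 \<Omega>" for y
  proof (rule Lorentz_invariant_imp_translation_invariant)
    fix A :: "complex^2^2" assume A: "A \<in> SL2C"
    obtain \<kappa> where \<kappa>: "cnj \<kappa> * \<kappa> = 1" "adj ip UNIV (U (0, A)) \<Omega> = sm \<kappa> \<Omega>"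
      using adj_U_vacuum[OF A] by blast
    have "sm \<kappa> (U (0, A) (phi 1 0 \<Omega>)) = phi 1 0 \<Omega>"
      using cov1[OF A, of 0 0] n by (simp add: \<kappa>(2) scale U_scale in_Poincare A Lam_zero)
    then have "sm (cnj \<kappa>) (phi 1 0 \<Omega>) = U (0, A) (phi 1 0 \<Omega>)"
      using \<kappa>(1) by (metis scale_one scale_scale)
    then show "\<exists>\<kappa>. cnj \<kappa> * \<kappa> = 1 \<and> U (0, A) (phi 1 0 \<Omega>) = sm \<kappa> (phi 1 0 \<Omega>)"
      using \<kappa>(1) by (metis complex_cnj_cnj mult.commute)
  qed
  moreover have "phi 1 0 \<Omega> \<in> D" using dom n by simp
  ultimately obtain c where c: "phi 1 0 \<Omega> = sm c \<Omega>" using vacuum_unique by blast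
  \<comment> \<open>Translation covariance carries the value at the origin to x.\<close>
  have "phi 1 x \<Omega> = sm c \<Omega>" for x
  proof -
    note T = in_Poincare[OF mat_1_in_SL2C]
    have "adj ip UNIV (U (x, mat 1)) \<Omega> = \<Omega>" by (metis T adj_U vacuum(3))
    then have "phi 1 x \<Omega> = U (x, mat 1) (phi 1 0 \<Omega>)"
      using cov1[OF mat_1_in_SL2C, of x 0] by (simp add: Lam_zero)
    then show ?thesis using vacuum(3) by (simp only: c U_scale T)
  qed
  moreover have "phi i x \<Omega> = 0" if i: "i \<in> {2..n}" for i x
  proof (rule isometric_S_rep_vectors_eq_0[OF jj n S _ i])
    fix B :: "complex^2^2" assume "B \<in> SL2C"
    then obtain A where A: "A \<in> SL2C" "B = \<sigma> A" using \<sigma> by blast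
    \<comment> \<open>This translation makes (a, A) fix the point x, so covariance becomes a linear
      action on the finitely many vectors at x.\<close>
    define a where "a = x - Lam A x"
    have ax: "Lam A x + a = x" by (simp add: a_def)
    note g = in_Poincare[OF A(1), of a]
    obtain \<kappa> where \<kappa>: "cnj \<kappa> * \<kappa> = 1" "adj ip UNIV (U (a, A)) \<Omega> = sm \<kappa> \<Omega>"
      using adj_U_vacuum[OF A(1)] by blast
    show "\<exists>W. linear_on sm UNIV W \<and> (\<forall>v. ip (W v) (W v) = ip v v) \<and>
      (\<forall>\<alpha>\<in>{1..n}. W (phi \<alpha> x \<Omega>) = (\<Sum>\<beta>\<in>{1..n}. sm (S B \<alpha> \<beta>) (phi \<beta> x \<Omega>)))"
    \<comment> \<open>Absorbing the vacuum phase into the operator keeps it isometric.\<close>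
    proof (intro exI[of _ "\<lambda>v. sm \<kappa> (U (a, A) v)"] conjI allI ballI)
      show "linear_on sm UNIV (\<lambda>v. sm \<kappa> (U (a, A) v))"
        by (simp add: linear_on_def U_add U_scale g scale_right_distrib mult.commute)
      show "ip (sm \<kappa> (U (a, A) v)) (sm \<kappa> (U (a, A) v)) = ip v v" for v
        using \<kappa>(1) by (simp add: ip_scale_left ip_scale_right U_isometric g mult_ac)
      show "sm \<kappa> (U (a, A) (phi \<alpha> x \<Omega>)) = (\<Sum>\<beta>\<in>{1..n}. sm (S B \<alpha> \<beta>) (phi \<beta> x \<Omega>))"
        if "\<alpha> \<in> {1..n}" for \<alpha>
        using cov[OF A(1) that, of a x]
        by (simp only: \<kappa>(2) scale[OF that] U_scale[OF g] A(2) ax)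
    qed
  qed
  ultimately show thesis by (rule that)
qed

end

section \<open>Application to the fields and to their adjoints\<close>

theorem theorem4:
  fixes sm :: "complex \<Rightarrow> 'h::ab_group_add \<Rightarrow> 'h"
    and ip :: "'h \<Rightarrow> 'h \<Rightarrow> complex"
    and D :: "'h set"
    and U :: "(real^4) \<times> (complex^2^2) \<Rightarrow> 'h \<Rightarrow> 'h"
    and m1 m2 n :: nat
    and S :: "complex^2^2 \<Rightarrow> nat \<Rightarrow> nat \<Rightarrow> complex"
    and psi :: "nat \<Rightarrow> real^4 \<Rightarrow> 'h \<Rightarrow> 'h"
    and \<Omega> :: 'h
  assumes H: "hilbert_space sm ip"
    and Dd: "dense_subspace sm ip D"
    and Urep: "unitary_rep sm ip U"
    and jj: "(m1, m2) \<noteq> (0, 0)"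
    and n_def: "n = 1 + (m1 + 1) * (m2 + 1)"
    and Srep: "is_S_rep m1 m2 S"
    and psi_lin: "\<forall>\<alpha>\<in>{1..n}. \<forall>x. linear_on sm D (psi \<alpha> x)"
    and A1: "weakly_continuous ip U"
    and A2: "\<forall>g\<in>Poincare. U g ` D \<subseteq> D \<and> adj ip UNIV (U g) ` D \<subseteq> D"
    and A3: "\<forall>\<alpha>\<in>{1..n}. \<forall>x. psi \<alpha> x ` D \<subseteq> D \<and>
               (\<forall>v\<in>D. in_adj_dom ip D (psi \<alpha> x) v \<and> adj ip D (psi \<alpha> x) v \<in> D)"
    and A4: "\<forall>a A. A \<in> SL2C \<longrightarrow> (\<forall>x. \<forall>\<alpha>\<in>{1..n}. \<forall>v\<in>D.
               U (a, A) (psi \<alpha> x (adj ip UNIV (U (a, A)) v)) =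
               (\<Sum>\<beta>\<in>{1..n}. sm (S (matrix_inv A) \<alpha> \<beta>) (psi \<beta> (Lam A x + a) v)))"
    and A5: "\<Omega> \<in> D" "\<Omega> \<noteq> 0" "\<forall>x. U (x, mat 1) \<Omega> = \<Omega>"
    and A5u: "\<forall>\<Phi>\<in>D. (\<forall>x. U (x, mat 1) \<Phi> = \<Phi>) \<longrightarrow> (\<exists>c. \<Phi> = sm c \<Omega>)"
  shows "\<exists>c. \<forall>x.
           psi 1 x \<Omega> = sm c \<Omega> \<and>
           adj ip D (psi 1 x) \<Omega> = sm (cnj c) \<Omega> \<and>
           (\<forall>i\<in>{2..n}. psi i x \<Omega> = 0 \<and> adj ip D (psi i x) \<Omega> = 0)"
proof -
  interpret poincare_vacuum sm ip D U \<Omega>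
    using H Urep A1 A2 A5 A5u by unfold_locales
  let ?adj = "\<lambda>\<alpha> x. adj ip D (psi \<alpha> x)"
  have ip_adj: "ip (?adj \<alpha> x v) u = ip v (psi \<alpha> x u)"
    if "\<alpha> \<in> {1..n}" "v \<in> D" "u \<in> D" for \<alpha> x v u
    using that A3 by (intro ip_adj_left Dd) auto
  have \<sigma>: "matrix_inv ` SL2C = SL2C"
    using matrix_inv_SL2C by (metis image_subset_iff rev_image_eqI subsetI subset_antisym)
  have \<sigma>': "(\<lambda>A. cnj_mat (matrix_inv A)) ` SL2C = SL2C"
    using \<sigma> cnj_mat_in_SL2C cnj_mat_cnj_mat
    by (metis image_image image_subset_iff rev_image_eqI subsetI subset_antisym)
  obtain c where c: "\<And>x. psi 1 x \<Omega> = sm c \<Omega>" "\<And>x i. i \<in> {2..n} \<Longrightarrow> psi i x \<Omega> = 0"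
  proof (rule covariant_family_vacuum[OF jj n_def Srep \<sigma>, of psi])
    show "psi \<alpha> x (sm c \<Omega>) = sm c (psi \<alpha> x \<Omega>)" if "\<alpha> \<in> {1..n}" for \<alpha> x c
      using psi_lin that A5(1) by (simp add: linear_on_def)
    show "psi \<alpha> x \<Omega> \<in> D" if "\<alpha> \<in> {1..n}" for \<alpha> x
      using A3 that A5(1) by blast
  qed (use A4 A5(1) in auto)
  obtain c' where c': "\<And>x. ?adj 1 x \<Omega> = sm c' \<Omega>" "\<And>x i. i \<in> {2..n} \<Longrightarrow> ?adj i x \<Omega> = 0"
  proof (rule covariant_family_vacuum[OF jj n_def is_S_rep_cnj[OF Srep] \<sigma>', of ?adj])
    show "?adj \<alpha> x (sm c \<Omega>) = sm c (?adj \<alpha> x \<Omega>)" if "\<alpha> \<in> {1..n}" for \<alpha> x c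
      using that A5(1) by (intro adj_eqI Dd) (simp add: ip_scale_left ip_adj)
    show "?adj \<alpha> x \<Omega> \<in> D" if "\<alpha> \<in> {1..n}" for \<alpha> x
      using A3 that A5(1) by blast
    fix a x \<alpha> and A :: "complex^2^2" assume A: "A \<in> SL2C" and \<alpha>: "\<alpha> \<in> {1..n}"
    let ?Ua = "adj ip UNIV (U (a, A))"
    note g = in_Poincare[OF A, of a]
    have UaD: "?Ua v \<in> D" if "v \<in> D" for v using A2 g that by blast
    have ip_U: "ip (U (a, A) v) w = ip v (?Ua w)" for v w
      by (metis U_adj[OF g] U_isometric[OF g])
    \<comment> \<open>The adjoint law has the conjugate of S[A^{-1}]; the double
      \<open>cnj_mat\<close> cancels and only matches the form of
      \<open>is_S_rep_cnj\<close>.\<close>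
    show "U (a, A) (?adj \<alpha> x (?Ua \<Omega>)) = (\<Sum>\<beta>\<in>{1..n}.
        sm (cnj (S (cnj_mat (cnj_mat (matrix_inv A))) \<alpha> \<beta>)) (?adj \<beta> (Lam A x + a) \<Omega>))"
    \<comment> \<open>Tested against u in D, all operators move to the right slot, where the law for
      \<open>psi\<close> applies.\<close>
    proof (rule eq_if_ip_left_eq_on_dense[OF Dd])
      fix u assume u: "u \<in> D"
      have "ip (U (a, A) (?adj \<alpha> x (?Ua \<Omega>))) u = ip (?Ua \<Omega>) (psi \<alpha> x (?Ua u))"
        using UaD u A5(1) \<alpha> by (simp add: ip_U ip_adj)
      also have "\<dots> = ip \<Omega> (U (a, A) (psi \<alpha> x (?Ua u)))"
        by (metis U_adj[OF g] U_isometric[OF g])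
      also have "\<dots> = (\<Sum>\<beta>\<in>{1..n}. S (matrix_inv A) \<alpha> \<beta> * ip \<Omega> (psi \<beta> (Lam A x + a) u))"
        using A4 A \<alpha> u by (simp add: ip_sum_right ip_scale_right)
      also have "\<dots> = ip (\<Sum>\<beta>\<in>{1..n}.
          sm (cnj (S (cnj_mat (cnj_mat (matrix_inv A))) \<alpha> \<beta>)) (?adj \<beta> (Lam A x + a) \<Omega>)) u"
        using u A5(1) by (simp add: ip_sum_left ip_scale_left ip_adj)
      finally show "ip (U (a, A) (?adj \<alpha> x (?Ua \<Omega>))) u = ip (\<Sum>\<beta>\<in>{1..n}.
          sm (cnj (S (cnj_mat (cnj_mat (matrix_inv A))) \<alpha> \<beta>)) (?adj \<beta> (Lam A x + a) \<Omega>)) u" .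
    qed
  qed (use that in blast)
  \<comment> \<open>The vacuum expectation of the first component at the origin, computed with the
    adjoint and with the field.\<close>
  have "cnj c' * ip \<Omega> \<Omega> = c * ip \<Omega> \<Omega>"
    using ip_adj[OF _ A5(1) A5(1), of 1 0]
    unfolding c c' ip_scale_left ip_scale_right by (simp add: n_def)
  moreover have "ip \<Omega> \<Omega> \<noteq> 0" using A5(2) ip_self_eq_0 by blast
  ultimately have "c' = cnj c" by auto
  then show ?thesis using c c' by blast
qed

end
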